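(* Let $n\geq 1$ be an odd integer and let $q\ge 3$ be an integer. If $q$ has a prime factor $p$ such that $v_p(q) > \log_p n + 1$, then $S_n(q)=0$.
   Context: For an integer $q\ge 3$, let $\zeta=e^{2\pi i/q}$. For integers $u,v$ the Kloosterman sum is $$K(u,v;q)=\sum_{\substack{0<x\le q\\ (x,q)=1}}\zeta^{ux+v\bar x},$$ where $\bar x$ denotes the multiplicative inverse of $x$ in $(\mathbb{Z}/q\mathbb{Z})^*$. For a positive integer $n$, the $n$-th power moment is $$S_n(q)=\sum_{u=1}^q K(u,1;q)^n.$$ For a prime $p$, $v_p(q)$ denotes the $p$-adic valuation of $q$, and $\log_p$ is the real logarithm to base $p$. *)

theory Defs
  imports "HOL-Analysis.Analysis" "HOL-Number_Theory.Number_Theory"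
begin

definition zeta :: "nat \<Rightarrow> complex" where
  "zeta q = exp (2 * of_real pi * \<i> / of_nat q)"

definition kloosterman :: "int \<Rightarrow> int \<Rightarrow> nat \<Rightarrow> complex" where
  "kloosterman u v q =
     (\<Sum>x | 0 < x \<and> x \<le> int q \<and> coprime x (int q).
        zeta q powi (u * x + v * modular_inverse (int q) x))"

definition kloosterman_moment :: "nat \<Rightarrow> nat \<Rightarrow> complex" where
  "kloosterman_moment n q = (\<Sum>u = 1..int q. kloosterman u 1 q ^ n)"

end

theory Submission
  imports Defs
begin

text \<open>
  Write \<open>q = p\<^sup>a q'\<close> with \<open>a = v\<^sub>p(q)\<close>, so that the hypothesis on \<open>p\<close> says \<open>n < p\<^bsup>a-1\<^esup>\<close>.
  For \<open>p = 2\<close> every unit \<open>x\<close> modulo \<open>q\<close> is odd, hence replacing \<open>u\<close> by \<open>u + q/2\<close> changes the sign of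
  \<open>K(u,1;q)\<close> and of its odd powers, and the moment equals its own negative
  (\<open>odd_kloosterman_moment_even_modulus\<close>).

  Now let \<open>p\<close> be odd. Substituting
  \<open>t\<inverse> x\<close> for \<open>x\<close> shows \<open>K(u t\<^sup>2, 1) = K(u t, t)\<close>: multiplying \<open>u\<close> by the square of a unit \<open>t\<close>
  multiplies every exponent \<open>u x + x\<inverse>\<close> by \<open>t\<close>. The moment may therefore be averaged over the units
  \<open>t\<close> congruent to 1 modulo \<open>p q'\<close>. After expanding the \<open>n\<close>-th power, each \<open>n\<close>-tuple \<open>(x\<^sub>i)\<close> contributes
  the average of \<open>\<zeta>\<^bsup>t E\<^esup>\<close> with \<open>E = \<Sum>\<^sub>i (u x\<^sub>i + x\<^sub>i\<inverse>)\<close>, which is zero unless \<open>p\<^bsup>a-1\<^esup>\<close> divides \<open>E\<close>.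

  It remains to discard the tuples for which \<open>p\<^bsup>a-1\<^esup>\<close> does divide \<open>E\<close>, and this is what the \<open>p\<close>-adic
  method of stationary phase does (\<open>kloosterman_stationary_phase\<close>). With \<open>b = \<lfloor>a/2\<rfloor>\<close>, only
  those \<open>x\<close> contribute to \<open>K(u,1)\<close> for which the derivative \<open>u - x\<^bsup>-2\<^esup>\<close> of the phase vanishes modulo
  \<open>p\<^sup>b\<close>. Such \<open>x\<close> agree modulo \<open>p\<^sup>b\<close>, up to sign, with a fixed square root \<open>\<rho>\<close> of \<open>u\<inverse>\<close>, and since the phase is
  stationary there, its value is known to twice the precision: \<open>u x + x\<inverse>\<close> is congruent to
  \<open>2 u \<rho>\<close> or to \<open>-2 u \<rho>\<close> modulo \<open>p\<^bsup>2b\<^esup>\<close>, where \<open>2 b \<ge> a - 1\<close>. Thus \<open>E\<close> is congruent to \<open>2 u \<rho> k\<close> modulo \<open>p\<^bsup>a-1\<^esup>\<close>,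
  where \<open>k\<close> is a sum of \<open>n\<close> signs. As \<open>n\<close> is odd, \<open>k\<close> is odd, so \<open>0 < \<bar>k\<bar> \<le> n < p\<^bsup>a-1\<^esup>\<close>
  and \<open>p\<^bsup>a-1\<^esup>\<close> cannot divide \<open>E\<close> (\<open>stationary_phases_not_dvd\<close>).
\<close>

section \<open>Additive characters and complete residue systems\<close>

lemma zeta_powi: "zeta q powi k = exp (2 * of_real pi * \<i> * of_int k / of_nat q)"
  unfolding zeta_def exp_power_int by (simp add: mult_ac)

lemma zeta_powi_eq_1_iff:
  assumes "q > 0"
  shows "zeta q powi k = 1 \<longleftrightarrow> int q dvd k"
proof -
  have "zeta q powi k = 1 \<longleftrightarrow> (\<exists>m::int. 2 * pi * real_of_int k / real q = of_int (2 * m) * pi)"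
    unfolding zeta_powi exp_eq_1 by simp
  also have "\<dots> \<longleftrightarrow> (\<exists>m::int. real_of_int k = real_of_int (int q * m))"
    using assms by (intro ex_cong1) (auto simp: field_simps)
  also have "\<dots> \<longleftrightarrow> int q dvd k"
    unfolding of_int_eq_iff dvd_def by simp
  finally show ?thesis .
qed

lemma zeta_nonzero [simp]: "zeta q \<noteq> 0"
  by (simp add: zeta_def)

lemma zeta_powi_cong:
  assumes "q > 0" "[a = b] (mod int q)"
  shows "zeta q powi a = zeta q powi b"
proof -
  have "zeta q powi (a - b) = 1"
    using assms by (simp add: zeta_powi_eq_1_iff cong_iff_dvd_diff)
  then show ?thesis by (simp add: power_int_diff)
qed

lemma zeta_powi_sum: "zeta q powi (\<Sum>i\<in>A. f i) = (\<Prod>i\<in>A. zeta q powi f i)"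
  by (induction A rule: infinite_finite_induct) (simp_all add: power_int_add)

text \<open>
  Orthogonality of the characters modulo \<open>N\<close>, in the form needed for averaging over a step \<open>Q\<close>
  modulo \<open>N Q\<close>: the powers \<open>\<zeta>\<^bsup>Q k\<^esup>\<close> are exactly the \<open>N\<close>-th roots of unity.
\<close>

lemma sum_zeta_progression:
  fixes N Q :: nat and c :: int
  assumes "N > 0" "Q > 0"
  shows "(\<Sum>y<N. zeta (N * Q) powi (int Q * int y * c)) = (if int N dvd c then of_nat N else 0)"
proof -
  define w where "w = zeta (N * Q) powi (int Q * c)"
  have pw: "zeta (N * Q) powi (int Q * int y * c) = w ^ y" for y
    unfolding w_def by (simp flip: power_int_of_nat power_int_mult add: mult_ac)
  have w1: "w = 1 \<longleftrightarrow> int N dvd c"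
    using assms by (simp add: w_def zeta_powi_eq_1_iff mult.commute)
  have wN: "w ^ N = 1"
    unfolding pw[symmetric] using assms by (simp add: zeta_powi_eq_1_iff)
  show ?thesis
  proof (cases "int N dvd c")
    case True
    then have "w = 1" by (simp add: w1)
    with True show ?thesis by (simp add: pw)
  next
    case False
    then have "w \<noteq> 1" by (simp add: w1)
    with wN False show ?thesis by (simp add: pw geometric_sum)
  qed
qed

text \<open>
  All the substitutions below (\<open>x + Q y\<close>, \<open>t x\<close>, \<open>u t\<^sup>2\<close>, \<open>u + q/2\<close>) permute residue classes but leave the
  interval of representatives \<open>1, \<dots>, q\<close>. The predicate \<open>P\<close> selects the classes, e.g. the units.
\<close>

lemma sum_residues_reindex:
  fixes q :: int and f :: "int \<Rightarrow> 'a :: comm_monoid_add"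
  assumes q: "q > 0"
    and P: "\<And>x y. [x = y] (mod q) \<Longrightarrow> P x \<Longrightarrow> P y"
    and hP: "\<And>x. P x \<Longrightarrow> P (h x)"
    and inj: "\<And>x y. P x \<Longrightarrow> P y \<Longrightarrow> [h x = h y] (mod q) \<Longrightarrow> [x = y] (mod q)"
    and f: "\<And>x y. P x \<Longrightarrow> [x = y] (mod q) \<Longrightarrow> f x = f y"
  shows "(\<Sum>x | 0 < x \<and> x \<le> q \<and> P x. f (h x)) = (\<Sum>x | 0 < x \<and> x \<le> q \<and> P x. f x)"
proof -
  let ?R = "{x. 0 < x \<and> x \<le> q \<and> P x}"
  \<comment> \<open>The representative of \<open>h x\<close> in \<open>1, \<dots>, q\<close>; shifting by 1 represents the class of 0 by \<open>q\<close>.\<close>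
  define g where "g x = (h x - 1) mod q + 1" for x
  have gh: "[h x = g x] (mod q)" for x
    by (simp add: g_def cong_def mod_simps)
  have fin: "finite ?R"
    by (rule finite_subset[of _ "{1..q}"]) auto
  have "g ` ?R \<subseteq> ?R"
  proof
    fix z assume "z \<in> g ` ?R"
    then obtain x where x: "P x" "z = g x" by auto
    then have "P z" using P[OF gh hP] by simp
    moreover have "0 < z \<and> z \<le> q"
      using pos_mod_bound[OF q, of "h x - 1"] pos_mod_sign[OF q, of "h x - 1"]
      unfolding x(2) g_def by linarith
    ultimately show "z \<in> ?R" by simp
  qed
  moreover have "inj_on g ?R"
  proof (rule inj_onI)
    fix x y assume xy: "x \<in> ?R" "y \<in> ?R" "g x = g y"
    then have "[h x = h y] (mod q)"
      using gh[of x] gh[of y] by (metis cong_sym cong_trans)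
    then have "[x = y] (mod q)" using inj xy by blast
    then have "q dvd x - y" by (simp add: cong_iff_dvd_diff)
    moreover have "\<bar>x - y\<bar> < q" using xy by auto
    ultimately show "x = y" using zdvd_imp_le[of q "\<bar>x - y\<bar>"] by force
  qed
  ultimately have bij: "bij_betw g ?R ?R"
    using fin by (simp add: bij_betw_def endo_inj_surj)
  have "(\<Sum>x\<in>?R. f (h x)) = (\<Sum>x\<in>?R. f (g x))"
    by (intro sum.cong refl f gh hP) auto
  also have "\<dots> = (\<Sum>x\<in>?R. f x)"
    by (rule sum.reindex_bij_betw[OF bij])
  finally show ?thesis .
qed

section \<open>Kloosterman sums\<close>

lemma modular_inverse_cong:
  fixes x y m :: int
  assumes "[x * y = 1] (mod m)"
  shows "[modular_inverse m x = y] (mod m)"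
proof -
  have cop: "coprime x m"
    using assms by (auto simp: coprime_iff_invertible_int)
  have "[modular_inverse m x * (x * y) = modular_inverse m x * 1] (mod m)"
    by (intro cong_mult cong_refl assms)
  moreover have "[(modular_inverse m x * x) * y = 1 * y] (mod m)"
    by (intro cong_mult cong_refl cong_modular_inverse2 cop)
  ultimately show ?thesis
    by (metis cong_sym cong_trans mult.assoc mult_1 mult.right_neutral)
qed

lemma kloosterman_summand_cong:
  fixes q :: nat and x y :: int
  assumes q: "q > 0" and cop: "coprime x (int q)" and xy: "[x = y] (mod int q)"
  shows "zeta q powi (u * x + v * modular_inverse (int q) x) =
         zeta q powi (u * y + v * modular_inverse (int q) y)"
proof -
  have cy: "coprime y (int q)"
    using cop xy by (metis cong_imp_coprime)
  have "[x * modular_inverse (int q) y = y * modular_inverse (int q) y] (mod int q)"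
    by (intro cong_mult xy cong_refl)
  then have "[x * modular_inverse (int q) y = 1] (mod int q)"
    using cong_modular_inverse1[OF cy] by (rule cong_trans)
  then have "[modular_inverse (int q) x = modular_inverse (int q) y] (mod int q)"
    by (rule modular_inverse_cong)
  then show ?thesis
    by (intro zeta_powi_cong q cong_add cong_mult cong_refl xy)
qed

text \<open>
  Under the hypotheses \<open>q\<close> and \<open>Q\<close> have the same prime factors, so being a unit modulo \<open>q\<close> depends on the
  class modulo \<open>Q\<close> only.
\<close>

lemma coprime_add_mult_radical:
  fixes x y Q q :: int
  assumes "q dvd Q\<^sup>2" "Q dvd q" 
  shows "coprime (x + Q * y) q \<longleftrightarrow> coprime x q"
proof -
  have *: "coprime z q \<longleftrightarrow> coprime z Q" for z
    using assms by (meson coprime_divisors coprime_power_right_iff dvd_refl pos2)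
  show ?thesis
    unfolding * by (metis add.commute mult.commute coprime_iff_gcd_eq_1 gcd_add_mult gcd.commute)
qed

text \<open>
  The shift \<open>x + Q y\<close> has the inverse \<open>x\<inverse> - Q y x\<^bsup>-2\<^esup>\<close> modulo \<open>q\<close>, because \<open>q\<close> divides \<open>Q\<^sup>2\<close>. So the phase
  \<open>u x + v x\<inverse>\<close> is linear in \<open>y\<close>, with slope \<open>Q (u - v x\<^bsup>-2\<^esup>)\<close>, and averaging over \<open>y\<close> modulo \<open>N\<close> kills
  all terms whose slope is not zero modulo \<open>q\<close>.
\<close>

lemma kloosterman_stationary_phase:
  fixes N Q :: nat
  assumes q: "q = N * Q" "q > 0" and sq: "q dvd Q\<^sup>2"
  shows "kloosterman u v q =
    (\<Sum>x | 0 < x \<and> x \<le> int q \<and> coprime x (int q) \<and> int N dvd u * x\<^sup>2 - v.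
       zeta q powi (u * x + v * modular_inverse (int q) x))"
proof -
  let ?U = "{x. 0 < x \<and> x \<le> int q \<and> coprime x (int q)}"
  let ?inv = "modular_inverse (int q)"
  define \<phi> where "\<phi> x = zeta q powi (u * x + v * ?inv x)" for x
  \<comment> \<open>the derivative of the phase at \<open>x\<close>\<close>
  define d where "d x = u - v * (?inv x)\<^sup>2" for x
  have pos: "N > 0" "Q > 0" using q by auto
  have sqi: "int q dvd (int Q)\<^sup>2"
    using sq by (metis int_dvd_int_iff of_nat_power)
  have Qq: "int Q dvd int q" using q by simp
  have fin: "finite ?U" by (rule finite_subset[of _ "{1..int q}"]) auto
  have shift: "\<phi> (x + int Q * y) = \<phi> x * zeta q powi (int Q * y * d x)"
    if x: "coprime x (int q)" for x y
  proof -
    let ?b = "?inv x"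
    obtain k where k: "x * ?b = 1 + int q * k"
      using cong_modular_inverse1[OF x] by (metis add.commute cong_iff_lin cong_sym)
    obtain l where l: "(int Q)\<^sup>2 = int q * l" using sqi by (elim dvdE)
    have "(x + int Q * y) * (?b - int Q * y * ?b\<^sup>2) =
        x * ?b * (1 - int Q * y * ?b) + int Q * y * ?b - (int Q)\<^sup>2 * y\<^sup>2 * ?b\<^sup>2"
      by (simp add: algebra_simps power2_eq_square)
    also have "\<dots> = 1 + int q * (k * (1 - int Q * y * ?b) - l * y\<^sup>2 * ?b\<^sup>2)"
      unfolding k l by (simp add: algebra_simps)
    finally have "[(x + int Q * y) * (?b - int Q * y * ?b\<^sup>2) = 1] (mod int q)"
      by (simp add: cong_iff_dvd_diff)
    then have inv: "[?inv (x + int Q * y) = ?b - int Q * y * ?b\<^sup>2] (mod int q)"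
      by (rule modular_inverse_cong)
    have "\<phi> (x + int Q * y) =
        zeta q powi (u * (x + int Q * y) + v * (?b - int Q * y * ?b\<^sup>2))"
      unfolding \<phi>_def by (intro zeta_powi_cong cong_add cong_mult cong_refl inv q)
    also have "u * (x + int Q * y) + v * (?b - int Q * y * ?b\<^sup>2)
        = (u * x + v * ?b) + int Q * y * d x"
      by (simp add: d_def algebra_simps)
    finally show ?thesis by (simp add: \<phi>_def power_int_add)
  qed
  have K: "kloosterman u v q = (\<Sum>x\<in>?U. \<phi> x)"
    by (simp add: kloosterman_def \<phi>_def)
  have Ky: "kloosterman u v q = (\<Sum>x\<in>?U. \<phi> x * zeta q powi (int Q * y * d x))" for y
  proof -
    have "(\<Sum>x\<in>?U. \<phi> (x + int Q * y)) = (\<Sum>x\<in>?U. \<phi> x)"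
      by (rule sum_residues_reindex)
         (use q(2) in \<open>auto simp only: coprime_add_mult_radical[OF sqi Qq] \<phi>_def cong_add_rcancel
            of_nat_0_less_iff intro: cong_imp_coprime kloosterman_summand_cong\<close>)
    then show ?thesis by (simp add: K shift)
  qed
  have dN: "int N dvd d x \<longleftrightarrow> int N dvd u * x\<^sup>2 - v" if x: "coprime x (int q)" for x
  proof -
    have cN: "coprime (x\<^sup>2) (int N)" using x q by simp
    have "[x * ?inv x = 1] (mod int N)"
      using cong_modular_inverse1[OF x] q by (metis cong_modulus_mult of_nat_mult)
    then have "[(x * ?inv x)\<^sup>2 = 1\<^sup>2] (mod int N)" by (rule cong_pow)
    then have "[u * x\<^sup>2 - v * (x * ?inv x)\<^sup>2 = u * x\<^sup>2 - v * 1\<^sup>2] (mod int N)"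
      by (intro cong_diff cong_mult cong_refl)
    moreover have "u * x\<^sup>2 - v * (x * ?inv x)\<^sup>2 = x\<^sup>2 * d x"
      by (simp add: d_def algebra_simps)
    ultimately have "[x\<^sup>2 * d x = u * x\<^sup>2 - v] (mod int N)" by simp
    then have "int N dvd x\<^sup>2 * d x \<longleftrightarrow> int N dvd u * x\<^sup>2 - v" by (rule cong_dvd_iff)
    then show ?thesis
      using cN by (simp add: coprime_dvd_mult_right_iff coprime_commute)
  qed
  have "of_nat N * kloosterman u v q = (\<Sum>y<N. kloosterman u v q)" by simp
  also have "\<dots> = (\<Sum>y<N. \<Sum>x\<in>?U. \<phi> x * zeta q powi (int Q * int y * d x))"
    by (intro sum.cong refl Ky)
  also have "\<dots> = (\<Sum>x\<in>?U. \<phi> x * (\<Sum>y<N. zeta q powi (int Q * int y * d x)))"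
    by (subst sum.swap) (simp add: sum_distrib_left)
  also have "\<dots> = (\<Sum>x\<in>?U. if int N dvd u * x\<^sup>2 - v then of_nat N * \<phi> x else 0)"
    unfolding q(1) sum_zeta_progression[OF pos]
    by (intro sum.cong refl) (use dN q in auto)
  also have "\<dots> = (\<Sum>x \<in> {x\<in>?U. int N dvd u * x\<^sup>2 - v}. of_nat N * \<phi> x)"
    by (rule sum.inter_filter[OF fin, symmetric])
  also have "\<dots> = of_nat N * (\<Sum>x \<in> {x\<in>?U. int N dvd u * x\<^sup>2 - v}. \<phi> x)"
    by (simp add: sum_distrib_left)
  finally show ?thesis using pos by (simp add: \<phi>_def conj_assoc)
qed

text \<open>
  On the right-hand side the phase \<open>u x + x\<inverse>\<close> of \<open>K(u,1)\<close> is multiplied by \<open>t\<close>. So, over the units \<open>t\<close>, the values \<open>K(u t\<^sup>2, 1)\<close>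
  are the Galois conjugates of \<open>K(u,1)\<close> over the rationals.
\<close>

lemma kloosterman_mult_square:
  fixes t u :: int
  assumes q: "q > 0" and t: "coprime t (int q)"
  shows "kloosterman (u * t\<^sup>2) 1 q = kloosterman (u * t) t q"
proof -
  let ?U = "{x. 0 < x \<and> x \<le> int q \<and> coprime x (int q)}"
  let ?inv = "modular_inverse (int q)"
  let ?f = "\<lambda>x. zeta q powi (u * t * x + t * ?inv x)"
  have "kloosterman (u * t\<^sup>2) 1 q = (\<Sum>x\<in>?U. ?f (t * x))"
    unfolding kloosterman_def
  proof (intro sum.cong refl)
    fix x assume "x \<in> ?U"
    then have x: "coprime x (int q)" by simp
    have "[(t * x) * ?inv (t * x) = 1] (mod int q)"
      using t x by (intro cong_modular_inverse1) simp
    then have "[?inv x = t * ?inv (t * x)] (mod int q)"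
      by (intro modular_inverse_cong) (simp add: mult_ac)
    then have "[u * t\<^sup>2 * x + 1 * ?inv x = u * t\<^sup>2 * x + 1 * (t * ?inv (t * x))] (mod int q)"
      by (intro cong_add cong_mult cong_refl)
    then have "zeta q powi (u * t\<^sup>2 * x + 1 * ?inv x) =
        zeta q powi (u * t\<^sup>2 * x + 1 * (t * ?inv (t * x)))"
      by (rule zeta_powi_cong[OF q])
    then show "zeta q powi (u * t\<^sup>2 * x + 1 * ?inv x) = ?f (t * x)"
      by (simp add: power2_eq_square mult_ac)
  qed
  also have "\<dots> = (\<Sum>x\<in>?U. ?f x)"
    by (rule sum_residues_reindex)
       (use q t in \<open>auto intro: cong_imp_coprime kloosterman_summand_cong simp: cong_mult_lcancel\<close>)
  finally show ?thesis by (simp add: kloosterman_def)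
qed

lemma kloosterman_cong:
  assumes "q > 0" "[u = u'] (mod int q)"
  shows "kloosterman u v q = kloosterman u' v q"
  unfolding kloosterman_def
  by (intro sum.cong refl zeta_powi_cong cong_add cong_mult cong_refl assms)

lemma kloosterman_moment_reindex:
  assumes q: "q > 0"
    and inj: "\<And>x y. [h x = h y] (mod int q) \<Longrightarrow> [x = y] (mod int q)"
  shows "kloosterman_moment n q = (\<Sum>u = 1..int q. kloosterman (h u) 1 q ^ n)"
proof -
  have "(\<Sum>u | 0 < u \<and> u \<le> int q \<and> True. kloosterman (h u) 1 q ^ n) =
        (\<Sum>u | 0 < u \<and> u \<le> int q \<and> True. kloosterman u 1 q ^ n)"
    by (rule sum_residues_reindex)
       (use q in \<open>auto intro: inj kloosterman_cong[THEN arg_cong[where f = "\<lambda>z. z ^ n"]]\<close>)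
  moreover have "{u. 0 < u \<and> u \<le> int q \<and> True} = {1..int q}" by auto
  ultimately show ?thesis by (simp add: kloosterman_moment_def)
qed

section \<open>Vanishing of odd moments\<close>

lemma odd_kloosterman_moment_even_modulus:
  assumes q: "q > 0" "even q" and n: "odd n"
  shows "kloosterman_moment n q = 0"
proof -
  obtain m where m: "q = m * 2" using q by (metis dvd_def mult.commute)
  have neg: "kloosterman (u + int m) 1 q = - kloosterman u 1 q" for u
  proof -
    have "zeta q powi ((u + int m) * x + 1 * modular_inverse (int q) x) =
        - (zeta q powi (u * x + 1 * modular_inverse (int q) x))"
      if "coprime x (int q)" for x
    proof -
      have "odd x" using that m by auto
      have "(zeta q powi (int m * x))\<^sup>2 = zeta q powi (int q * x)"
        unfolding power2_eq_square by (simp add: m algebra_simps flip: power_int_add)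
      also have "\<dots> = 1" using q by (simp add: zeta_powi_eq_1_iff)
      finally have "zeta q powi (int m * x) = 1 \<or> zeta q powi (int m * x) = - 1"
        by (simp add: power2_eq_1_iff)
      moreover have "zeta q powi (int m * x) \<noteq> 1"
        using q \<open>odd x\<close> by (simp add: zeta_powi_eq_1_iff m)
      ultimately have "zeta q powi (int m * x) = - 1" by blast
      moreover have "(u + int m) * x + 1 * modular_inverse (int q) x =
          int m * x + (u * x + 1 * modular_inverse (int q) x)"
        by (simp add: algebra_simps)
      ultimately show ?thesis by (simp only: power_int_add zeta_nonzero simp_thms) simp
    qed
    then show ?thesis
      unfolding kloosterman_def sum_negf[symmetric] by (intro sum.cong refl) simp
  qed
  have "kloosterman_moment n q = (\<Sum>u = 1..int q. kloosterman (u + int m) 1 q ^ n)"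
    by (rule kloosterman_moment_reindex) (use q in \<open>simp_all add: cong_add_rcancel\<close>)
  also have "\<dots> = - kloosterman_moment n q"
    using n by (simp add: neg kloosterman_moment_def sum_negf)
  finally show ?thesis by simp
qed

text \<open>
  Here \<open>y i\<close> plays the inverse of \<open>x i\<close>. Let \<open>\<delta> = u (x 0)\<^sup>2 - 1\<close>, which is divisible by \<open>p\<^sup>b\<close>. One Newton step
  improves \<open>x 0\<close> to a square root of \<open>u\<inverse>\<close> modulo \<open>p\<^bsup>2b\<^esup>\<close>; its double is \<open>r = x 0 (2 - \<delta>)\<close>, and working with
  the double avoids dividing by 2. If \<open>\<epsilon> i\<close> is the sign with \<open>x i \<equiv> \<epsilon> i x 0\<close> modulo \<open>p\<^sup>b\<close>, then
  \<open>2 x i - \<epsilon> i r\<close> is divisible by \<open>p\<^sup>b\<close>, so its square vanishes modulo \<open>p\<^bsup>2b\<^esup>\<close>. Multiplied by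
  \<open>u y i\<close>, this square is \<open>4 (u x i + y i - u r \<epsilon> i)\<close> modulo \<open>p\<^bsup>2b\<^esup>\<close>, which evaluates every phase.
\<close>

lemma stationary_phases_not_dvd:
  fixes p u :: int and x y :: "nat \<Rightarrow> int"
  assumes p: "prime p" "odd p" and d: "d \<le> 2 * b"
    and n: "odd n" "int n < p ^ d"
    and ux: "\<And>i. i < n \<Longrightarrow> p ^ b dvd u * (x i)\<^sup>2 - 1"
    and xy: "\<And>i. i < n \<Longrightarrow> p ^ (2 * b) dvd x i * y i - 1"
  shows "\<not> p ^ d dvd (\<Sum>i<n. u * x i + y i)"
proof
  assume dvd: "p ^ d dvd (\<Sum>i<n. u * x i + y i)"
  have cop: "coprime (p ^ c) z" if "\<not> p dvd z" for c z
    using prime_imp_coprime[OF p(1) that] by simp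
  have n0: "n > 0" using n by (auto intro: Nat.gr0I)
  have b: "b > 0" using d n n0 by (cases b) auto
  define \<delta> where "\<delta> = u * (x 0)\<^sup>2 - 1"
  define r where "r = x 0 * (2 - \<delta>)"
  define \<epsilon> :: "nat \<Rightarrow> int" where "\<epsilon> i = (if p ^ b dvd x i - x 0 then 1 else - 1)" for i
  have \<delta>: "p ^ b dvd \<delta>" using ux[OF n0] by (simp add: \<delta>_def)
  have \<delta>2: "p ^ (2 * b) dvd \<delta>\<^sup>2"
    using \<delta> by (metis dvd_power_same power_mult mult.commute)
  have ur: "u * r\<^sup>2 = 4 + \<delta>\<^sup>2 * (\<delta> - 3)"
  proof -
    have "u * r\<^sup>2 = (u * (x 0)\<^sup>2) * (2 - \<delta>)\<^sup>2" by (simp add: r_def power_mult_distrib)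
    also have "u * (x 0)\<^sup>2 = 1 + \<delta>" by (simp add: \<delta>_def)
    finally show ?thesis by (simp add: algebra_simps power2_eq_square)
  qed
  have nu: "\<not> p dvd u"
  proof
    assume "p dvd u"
    moreover have "p dvd \<delta>" using \<delta> b by (meson dvd_power dvd_trans)
    ultimately have "p dvd u * (x 0)\<^sup>2 - \<delta>" by simp
    then have "p dvd 1" by (simp add: \<delta>_def)
    then show False using p(1) by (simp only: not_prime_unit)
  qed
  have nx: "\<not> p dvd x i" if "i < n" for i
  proof
    assume "p dvd x i"
    have "p dvd u * (x i)\<^sup>2 - 1" using ux[OF that] b by (meson dvd_power dvd_trans)
    moreover have "p dvd u * (x i)\<^sup>2" using \<open>p dvd x i\<close> by (simp add: power2_eq_square)
    ultimately have "p dvd u * (x i)\<^sup>2 - (u * (x i)\<^sup>2 - 1)" by (metis dvd_diff)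
    then have "p dvd 1" by simp
    then show False using p(1) by (simp only: not_prime_unit)
  qed
  have np2: "\<not> p dvd 2"
    using p by (metis prime_int_numeral_eq primes_dvd_imp_eq two_is_prime_nat dvd_refl)
  \<comment> \<open>The \<open>x i\<close> have the same square modulo \<open>p\<^sup>b\<close>, and as \<open>p\<close> is odd it cannot divide both factors of
    the difference of two squares.\<close>
  have sgn: "p ^ b dvd x i - \<epsilon> i * x 0" if i: "i < n" for i
  proof (cases "p ^ b dvd x i - x 0")
    case False
    have "p ^ b dvd (u * (x i)\<^sup>2 - 1) - (u * (x 0)\<^sup>2 - 1)"
      using ux[OF i] ux[OF n0] by (rule dvd_diff)
    also have "\<dots> = u * ((x i - x 0) * (x i + x 0))"
      by (simp add: algebra_simps power2_eq_square)
    finally have *: "p ^ b dvd (x i - x 0) * (x i + x 0)"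
      using cop[OF nu] by (simp add: coprime_dvd_mult_right_iff)
    have nboth: "\<not> (p dvd x i - x 0 \<and> p dvd x i + x 0)"
    proof
      assume "p dvd x i - x 0 \<and> p dvd x i + x 0"
      then have "p dvd (x i - x 0) + (x i + x 0)" using dvd_add by blast
      also have "\<dots> = 2 * x i" by simp
      finally have "p dvd 2 * x i" .
      then show False using p np2 nx[OF i] by (simp add: prime_dvd_mult_iff)
    qed
    have "\<not> p dvd x i - x 0"
    proof
      assume "p dvd x i - x 0"
      with nboth have "\<not> p dvd x i + x 0" by blast
      then have "coprime (p ^ b) (x i + x 0)" by (rule cop)
      with * False show False by (simp add: coprime_dvd_mult_left_iff)
    qed
    then have "coprime (p ^ b) (x i - x 0)" by (rule cop)
    with * have "p ^ b dvd x i + x 0" by (simp add: coprime_dvd_mult_right_iff)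
    with False show ?thesis by (simp add: \<epsilon>_def)
  qed (simp add: \<epsilon>_def)
  have eps: "(\<epsilon> i)\<^sup>2 = 1" "odd (\<epsilon> i)" "\<bar>\<epsilon> i\<bar> \<le> 1" for i by (auto simp: \<epsilon>_def)
  have phase: "p ^ (2 * b) dvd (u * x i + y i) - u * r * \<epsilon> i" if i: "i < n" for i
  proof -
    have "p ^ b dvd 2 * (x i - \<epsilon> i * x 0) + \<epsilon> i * x 0 * \<delta>"
      using sgn[OF i] \<delta> by (intro dvd_add dvd_mult)
    also have "\<dots> = 2 * x i - \<epsilon> i * r" by (simp add: r_def algebra_simps)
    finally have sq: "p ^ (2 * b) dvd (2 * x i - \<epsilon> i * r)\<^sup>2"
      by (metis dvd_power_same power_mult mult.commute)
    have "4 * ((u * x i + y i) - u * r * \<epsilon> i) =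
        u * y i * (2 * x i - \<epsilon> i * r)\<^sup>2
        - (x i * y i - 1) * (4 * u * x i - 4 * u * \<epsilon> i * r)
        - y i * (u * r\<^sup>2 - 4) - u * y i * r\<^sup>2 * ((\<epsilon> i)\<^sup>2 - 1)"
      by (simp add: algebra_simps power2_eq_square)
    moreover have "p ^ (2 * b) dvd \<dots>"
      using sq xy[OF i] \<delta>2 by (intro dvd_diff) (simp_all add: ur eps(1))
    ultimately have "p ^ (2 * b) dvd 2\<^sup>2 * ((u * x i + y i) - u * r * \<epsilon> i)" by simp
    moreover have "coprime (p ^ (2 * b)) (2\<^sup>2)"
      using cop[OF np2] by (simp only: coprime_power_right_iff simp_thms)
    ultimately show ?thesis by (simp only: coprime_dvd_mult_right_iff)
  qed
  define k where "k = (\<Sum>i<n. \<epsilon> i)"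
  have "p ^ (2 * b) dvd (\<Sum>i<n. (u * x i + y i) - u * r * \<epsilon> i)"
    by (intro dvd_sum phase) simp
  then have "p ^ d dvd (\<Sum>i<n. (u * x i + y i) - u * r * \<epsilon> i)"
    using d by (meson dvd_trans le_imp_power_dvd)
  then have "p ^ d dvd (\<Sum>i<n. u * x i + y i) - (\<Sum>i<n. (u * x i + y i) - u * r * \<epsilon> i)"
    using dvd by simp
  also have "\<dots> = (u * r) * k"
    by (simp add: sum_subtractf k_def sum_distrib_left)
  finally have "p ^ d dvd (u * r) * k" .
  moreover have "coprime (p ^ d) (u * r)"
  proof -
    have "\<not> p dvd u * r"
    proof
      assume "p dvd u * r"
      then have "p dvd u * r\<^sup>2" by (simp add: power2_eq_square mult.assoc[symmetric])
      moreover have "p dvd \<delta>\<^sup>2" using \<delta> b by (meson dvd_power dvd_trans pos2)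
      ultimately have "p dvd u * r\<^sup>2 - \<delta>\<^sup>2 * (\<delta> - 3)" by simp
      then have "p dvd 2\<^sup>2" by (simp add: ur)
      then show False using np2 p prime_dvd_power by blast
    qed
    then show ?thesis by (rule cop)
  qed
  ultimately have "p ^ d dvd k" by (simp add: coprime_dvd_mult_right_iff)
  moreover have "odd k"
    unfolding k_def using n eps(2) by (simp add: even_sum_iff)
  then have "k \<noteq> 0" by auto
  ultimately have "p ^ d \<le> \<bar>k\<bar>" by (intro zdvd_imp_le) simp_all
  also have "\<bar>k\<bar> \<le> (\<Sum>i<n. \<bar>\<epsilon> i\<bar>)" unfolding k_def by (rule sum_abs)
  also have "\<dots> \<le> (\<Sum>i<n. 1)" by (intro sum_mono eps)
  finally show False using n by simp
qed

text \<open>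
  The averaging argument: the units \<open>t = 1 + p q' y\<close> act on the moment by \<open>u \<mapsto> u t\<^sup>2\<close>, and for each
  tuple of stationary points the sum over \<open>t\<close> is a complete sum of \<open>p\<^bsup>a-1\<^esup>\<close>-th roots of unity that
  vanishes.
\<close>

lemma odd_kloosterman_moment_odd_prime:
  fixes p q' a n :: nat
  assumes p: "prime p" "odd p" and q: "q = p ^ a * q'" "q > 0"
    and n: "odd n" "n < p ^ (a - 1)"
  shows "kloosterman_moment n q = 0"
proof -
  let ?inv = "modular_inverse (int q)"
  define b where "b = a div 2"
  define d where "d = a - 1"
  define Q where "Q = p * q'"
  define A where
    "A u = {x. 0 < x \<and> x \<le> int q \<and> coprime x (int q) \<and> int (p ^ b) dvd u * x\<^sup>2 - 1}" for u
  define E where "E u g = (\<Sum>i<n. u * g i + ?inv (g i))" for u g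
  have n0: "n > 0" using n by (auto intro: Nat.gr0I)
  have a: "a \<ge> 2" using n n0 by (cases "a \<le> 1") (auto simp: le_Suc_eq)
  have pos: "p ^ d > 0" "Q > 0" using q p by (auto simp: Q_def prime_gt_0_nat intro: Nat.gr0I)
  have qdQ: "q = p ^ d * Q"
    using a by (simp add: q(1) d_def Q_def power_eq_if)
  have qb: "q = p ^ b * (p ^ (a - b) * q')"
    by (simp add: q(1) b_def flip: power_add mult.assoc)
  have sqb: "q dvd (p ^ (a - b) * q')\<^sup>2"
    unfolding q(1) power_mult_distrib power_mult[symmetric]
    by (intro mult_dvd_mono le_imp_power_dvd) (auto simp: b_def)
  have finA: "finite (A u)" for u
    by (rule finite_subset[of _ "{1..int q}"]) (auto simp: A_def)
  \<comment> \<open>\<open>Q\<close> contains every prime factor of \<open>q\<close>.\<close>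
  have t: "coprime (1 + int Q * y) (int q)" for y
  proof -
    have *: "coprime (1 + int Q * y) (int Q)"
      by (metis add.commute coprime_1_left coprime_iff_gcd_eq_1 gcd.commute gcd_add_mult mult.commute)
    then have "coprime (1 + int Q * y) (int p)" "coprime (1 + int Q * y) (int q')"
      by (simp_all add: Q_def)
    then show ?thesis by (simp add: q(1))
  qed
  have K: "kloosterman (u * t\<^sup>2) 1 q ^ n =
      (\<Sum>g \<in> PiE {..<n} (\<lambda>_. A u). zeta q powi (t * E u g))"
    if t: "coprime t (int q)" for u t
  proof -
    have "kloosterman (u * t\<^sup>2) 1 q = kloosterman (u * t) t q"
      by (rule kloosterman_mult_square[OF q(2) t])
    also have "\<dots> = (\<Sum>x | 0 < x \<and> x \<le> int q \<and> coprime x (int q) \<and>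
        int (p ^ b) dvd u * t * x\<^sup>2 - t. zeta q powi (u * t * x + t * ?inv x))"
      by (rule kloosterman_stationary_phase[OF qb q(2) sqb])
    also have "\<dots> = (\<Sum>x\<in>A u. zeta q powi (t * (u * x + ?inv x)))"
    proof (rule sum.cong)
      have "coprime (int (p ^ b)) t"
        using t qb by (simp add: coprime_commute)
      moreover have "u * t * x\<^sup>2 - t = t * (u * x\<^sup>2 - 1)" for x
        by (simp add: algebra_simps)
      ultimately show "{x. 0 < x \<and> x \<le> int q \<and> coprime x (int q) \<and>
          int (p ^ b) dvd u * t * x\<^sup>2 - t} = A u"
        unfolding A_def by (simp only: coprime_dvd_mult_right_iff)
    qed (simp add: algebra_simps)
    finally have "kloosterman (u * t\<^sup>2) 1 q ^ n =
        (\<Prod>i<n. \<Sum>x\<in>A u. zeta q powi (t * (u * x + ?inv x)))"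
      by simp
    also have "\<dots> = (\<Sum>g \<in> PiE {..<n} (\<lambda>_. A u). \<Prod>i<n. zeta q powi (t * (u * g i + ?inv (g i))))"
      by (rule prod_sum_PiE) (auto simp: finA)
    also have "\<dots> = (\<Sum>g \<in> PiE {..<n} (\<lambda>_. A u). zeta q powi (t * E u g))"
      by (simp add: E_def sum_distrib_left zeta_powi_sum)
    finally show ?thesis .
  qed
  have ndvd: "\<not> int (p ^ d) dvd E u g" if g: "g \<in> PiE {..<n} (\<lambda>_. A u)" for u g
    unfolding E_def of_nat_power
  proof (rule stationary_phases_not_dvd)
    show "prime (int p)" "odd (int p)" using p by auto
    show "d \<le> 2 * b" by (simp add: d_def b_def)
    show "int n < int p ^ d" using n(2) unfolding d_def by (metis of_nat_less_iff of_nat_power)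
    show "odd n" by fact
  next
    fix i assume "i < n"
    then have gi: "g i \<in> A u" using g by auto
    then show "int p ^ b dvd u * (g i)\<^sup>2 - 1" by (simp add: A_def)
    have "int q dvd g i * ?inv (g i) - 1"
      using gi cong_modular_inverse1[of "g i" "int q"] by (simp add: A_def cong_iff_dvd_diff)
    moreover have "int p ^ (2 * b) dvd int q"
      by (simp add: q(1) b_def le_imp_power_dvd dvd_mult2)
    ultimately show "int p ^ (2 * b) dvd g i * ?inv (g i) - 1" by (rule dvd_trans[rotated])
  qed
  have S: "kloosterman_moment n q =
      (\<Sum>u = 1..int q. \<Sum>g \<in> PiE {..<n} (\<lambda>_. A u). zeta q powi ((1 + int Q * int y) * E u g))" for y
  proof -
    have "kloosterman_moment n q =
        (\<Sum>u = 1..int q. kloosterman (u * (1 + int Q * int y)\<^sup>2) 1 q ^ n)"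
      by (rule kloosterman_moment_reindex) (use q t in \<open>simp_all add: cong_mult_rcancel\<close>)
    then show ?thesis by (simp add: K t)
  qed
  have "of_nat (p ^ d) * kloosterman_moment n q = (\<Sum>y<p ^ d. kloosterman_moment n q)" by simp
  also have "\<dots> = (\<Sum>y<p ^ d. \<Sum>u = 1..int q. \<Sum>g \<in> PiE {..<n} (\<lambda>_. A u).
      zeta q powi ((1 + int Q * int y) * E u g))"
    by (intro sum.cong refl S)
  also have "\<dots> = (\<Sum>u = 1..int q. \<Sum>g \<in> PiE {..<n} (\<lambda>_. A u). \<Sum>y<p ^ d.
      zeta q powi ((1 + int Q * int y) * E u g))"
    by (subst sum.swap, intro sum.cong refl, rule sum.swap)
  also have "\<dots> = (\<Sum>u = 1..int q. \<Sum>g \<in> PiE {..<n} (\<lambda>_. A u).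
      zeta q powi E u g * (\<Sum>y<p ^ d. zeta (p ^ d * Q) powi (int Q * int y * E u g)))"
    by (simp add: distrib_right power_int_add sum_distrib_left flip: qdQ)
  also have "\<dots> = 0"
    using ndvd by (intro sum.neutral ballI) (simp only: sum_zeta_progression[OF pos] if_False mult_zero_right)
  finally show ?thesis using p(1) by auto
qed

theorem theorem1:
  fixes n q :: nat
  assumes "n \<ge> 1" and "odd n" and "q \<ge> 3"
    and "\<exists>p::nat. prime p \<and> p dvd q \<and> real (multiplicity p q) > log (real p) (real n) + 1"
  shows "kloosterman_moment n q = 0"
proof -
  obtain p :: nat where p: "prime p" "p dvd q"
      and a: "real (multiplicity p q) > log (real p) (real n) + 1"
    using assms(4) by blast
  show ?thesis
  proof (cases "p = 2")
    case True
    then show ?thesis using p assms by (intro odd_kloosterman_moment_even_modulus) auto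
  next
    case False
    then have "odd p" using p primes_dvd_imp_eq two_is_prime_nat by blast
    have p1: "real p > 1" using p(1) prime_gt_1_nat by simp
    have "log (real p) (real n) \<ge> 0" using p1 assms(1) by simp
    with a have a1: "multiplicity p q \<ge> 1" by linarith
    with a have "log (real p) (real n) < real (multiplicity p q - 1)" by (simp add: of_nat_diff)
    then have "real n < real p ^ (multiplicity p q - 1)"
      using p1 assms(1) by (simp add: log_less_iff powr_realpow)
    then have "n < p ^ (multiplicity p q - 1)" by (metis of_nat_less_iff of_nat_power)
    moreover have "q = p ^ multiplicity p q * (q div p ^ multiplicity p q)"
      by (simp add: multiplicity_dvd)
    ultimately show ?thesis
      using p \<open>odd p\<close> assms by (intro odd_kloosterman_moment_odd_prime) auto
  qed
qed

end
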